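(* Let $k\ge 0$ be an integer, let $A_k=\mathbb{Z}[x_1,\ldots,x_k]$, and let $B$ be a superreflexive Banach space. If the pair $EL_2(A_k)\ltimes A_k^2\triangleright A_k^2$ has relative property $(\mathrm{T}_B)$, then the pair $SL_3(A_k)\ltimes A_k^3\triangleright A_k^3$ has relative property $(\mathrm{F}_B)$.
   Context: All the groups here are discrete. $EL_n(A)$ denotes the group of $n\times n$ matrices over the unital ring $A$ generated by the elementary matrices $E_{i,j}(a)$ ($i\ne j$, $a\in A$), where $E_{i,j}(a)$ has $1$'s on the diagonal, $a$ in the $(i,j)$-th entry, and $0$ elsewhere. In $EL_2(A_k)\ltimes A_k^2$ and $SL_3(A_k)\ltimes A_k^3$ the matrix group acts on column vectors by left multiplication. Banach spaces are over $\mathbb{C}$. A Banach space is uniformly convex if for all $0<\varepsilon<2$ one has $\inf\{1-\|\xi+\eta\|/2:\ \|\xi\|\le 1,\|\eta\|\le 1,\|\xi-\eta\|\ge\varepsilon\}>0$; it is uniformly smooth if $r(\tau)/\tau\to 0$ as $\tau\to 0$, where $r(\tau)=\sup\{(\|\xi+\eta\|+\|\xi-\eta\|)/2-1:\ \|\xi\|\le1,\|\eta\|\le\tau\}$. A Banach space is superreflexive if it is isomorphic to a Banach space that is both uniformly convex and uniformly smooth. An isometric representation of a group $G$ on $B$ is a (strongly continuous) homomorphism from $G$ to the group of surjective linear isometries of $B$. A representation $\rho$ of $G$ on a Banach space $E$ admits almost invariant vectors if for every compact subset $F\subset G$ and every $\varepsilon>0$ there is a unit vector $\xi\in E$ with $\sup_{s\in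 F}\|\rho(s)\xi-\xi\|\le\varepsilon$. A pair $G\triangleright N$ (with $N$ a normal subgroup of $G$) has relative property $(\mathrm{T}_B)$ if for every isometric representation $\rho$ of $G$ on $B$, the isometric representation of $G$ on the quotient Banach space $B/B^{\rho(N)}$ naturally induced by $\rho$ does not admit almost invariant vectors, where $B^{\rho(N)}$ is the subspace of $\rho(N)$-invariant vectors. An affine isometric action $\alpha$ of $G$ on $B$ is an action of the form $\alpha(g)\xi=\rho(g)\xi+c(g)$ with $\rho$ an isometric representation and $c(g)\in B$. A pair $G>N$ has relative property $(\mathrm{F}_B)$ if every affine isometric action of $G$ on $B$ has an $N$-fixed point. *)

theory Defs
  imports
    "HOL-Analysis.Analysis"
    "HOL-Algebra.Generated_Groups"
    "HOL-Algebra.Group_Action"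
    "HOL-Library.Poly_Mapping"
begin

subsection \<open>Polynomial rings, linear groups and semidirect products\<close>

text \<open>Integer polynomials in countably many indeterminates: monomials are finitely supported
  exponent functions. The ring in \<open>k\<close> indeterminates is the subring of those polynomials
  in which only the indeterminates with index below \<open>k\<close> occur.\<close>

type_synonym zpoly = "(nat \<Rightarrow>\<^sub>0 nat) \<Rightarrow>\<^sub>0 int"

definition zpoly_ring :: "nat \<Rightarrow> zpoly set" where
  "zpoly_ring k = {p. \<forall>m\<in>Poly_Mapping.keys p. Poly_Mapping.keys m \<subseteq> {..<k}}"

text \<open>In the following definitions, \<open>A\<close> is a subring of the commutative ring given by the type.\<close>

definition matrices_over :: "'a set \<Rightarrow> ('a::comm_ring_1^'n^'n) set" where
  "matrices_over A = {M. \<forall>i j. M $ i $ j \<in> A}"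

definition vectors_over :: "'a set \<Rightarrow> ('a::comm_ring_1^'n) set" where
  "vectors_over A = {v. \<forall>i. v $ i \<in> A}"

definition GL :: "'a set \<Rightarrow> ('a::comm_ring_1^'n^'n) monoid" where
  "GL A = units_of \<lparr>carrier = matrices_over A, monoid.mult = (**), one = mat 1\<rparr>"

definition elementary_matrix :: "'n \<Rightarrow> 'n \<Rightarrow> 'a \<Rightarrow> 'a::comm_ring_1^'n^'n" where
  "elementary_matrix i j a =
     (\<chi> r s. if r = s then 1 else if r = i \<and> s = j then a else 0)"

definition EL :: "'a set \<Rightarrow> ('a::comm_ring_1^'n^'n) set" where
  "EL A = generate (GL A) {elementary_matrix i j a | i j a. i \<noteq> j \<and> a \<in> A}"

definition SL :: "'a set \<Rightarrow> ('a::comm_ring_1^'n^'n) set" where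
  "SL A = {M \<in> matrices_over A. det M = 1}"

definition semidirect ::
    "('a::comm_ring_1^'n^'n) set \<Rightarrow> 'a set \<Rightarrow> (('a^'n^'n) \<times> ('a^'n)) monoid" where
  "semidirect H A =
     \<lparr>carrier = H \<times> vectors_over A,
      monoid.mult = (\<lambda>(g, v) (h, w). (g ** h, v + g *v w)),
      one = (mat 1, 0)\<rparr>"

definition translation_subgroup :: "'a set \<Rightarrow> (('a::comm_ring_1^'n^'n) \<times> ('a^'n)) set" where
  "translation_subgroup A = {mat 1} \<times> vectors_over A"


subsection \<open>Complex Banach spaces\<close>

class complex_banach = banach +
  fixes scaleC :: "complex \<Rightarrow> 'a \<Rightarrow> 'a" (infixr \<open>*\<^sub>C\<close> 75)
  assumes scaleC_add_right: "c *\<^sub>C (x + y) = c *\<^sub>C x + c *\<^sub>C y"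
    and scaleC_add_left: "(c + d) *\<^sub>C x = c *\<^sub>C x + d *\<^sub>C x"
    and scaleC_scaleC: "c *\<^sub>C (d *\<^sub>C x) = (c * d) *\<^sub>C x"
    and scaleC_of_real: "complex_of_real r *\<^sub>C x = r *\<^sub>R x"
    and norm_scaleC: "norm (c *\<^sub>C x) = cmod c * norm x"

text \<open>The Banach space acted upon is a type of the class above. Its quotients, and the spaces to
  which it is compared by an isomorphism, are not types; they are spaces with explicit carrier.\<close>

record 'v cspace = "'v partial_object" +
  vadd :: "'v \<Rightarrow> 'v \<Rightarrow> 'v"
  vzero :: 'v
  vscale :: "complex \<Rightarrow> 'v \<Rightarrow> 'v"
  vnorm :: "'v \<Rightarrow> real"

definition vdiff :: "'v cspace \<Rightarrow> 'v \<Rightarrow> 'v \<Rightarrow> 'v" where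
  "vdiff V x y = vadd V x (vscale V (-1) y)"

locale complex_normed_space =
  fixes V :: "'v cspace"
  assumes additive_group: "comm_group \<lparr>carrier = carrier V, monoid.mult = vadd V, one = vzero V\<rparr>"
    and vscale_closed: "x \<in> carrier V \<Longrightarrow> vscale V c x \<in> carrier V"
    and vscale_vadd: "\<lbrakk>x \<in> carrier V; y \<in> carrier V\<rbrakk> \<Longrightarrow>
          vscale V c (vadd V x y) = vadd V (vscale V c x) (vscale V c y)"
    and vscale_add: "x \<in> carrier V \<Longrightarrow>
          vscale V (c + d) x = vadd V (vscale V c x) (vscale V d x)"
    and vscale_vscale: "x \<in> carrier V \<Longrightarrow> vscale V c (vscale V d x) = vscale V (c * d) x"
    and vscale_one: "x \<in> carrier V \<Longrightarrow> vscale V 1 x = x"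
    and vnorm_nonneg: "x \<in> carrier V \<Longrightarrow> 0 \<le> vnorm V x"
    and vnorm_eq_0: "x \<in> carrier V \<Longrightarrow> vnorm V x = 0 \<longleftrightarrow> x = vzero V"
    and vnorm_vscale: "x \<in> carrier V \<Longrightarrow> vnorm V (vscale V c x) = cmod c * vnorm V x"
    and vnorm_triangle: "\<lbrakk>x \<in> carrier V; y \<in> carrier V\<rbrakk> \<Longrightarrow>
          vnorm V (vadd V x y) \<le> vnorm V x + vnorm V y"

text \<open>Completeness is written out rather than taken from \<open>Metric_space\<close>, whose distance function has to be
  symmetric and nonnegative also outside the carrier.\<close>

locale complex_banach_space = complex_normed_space +
  assumes complete:
    "\<lbrakk>range X \<subseteq> carrier V;
      \<forall>e>0. \<exists>n0. \<forall>m\<ge>n0. \<forall>n\<ge>n0. vnorm V (vdiff V (X m) (X n)) < e\<rbrakk> \<Longrightarrow>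
     \<exists>x\<in>carrier V. (\<lambda>n. vnorm V (vdiff V (X n) x)) \<longlonglongrightarrow> 0"

definition space_of :: "'b::complex_banach itself \<Rightarrow> 'b cspace" where
  "space_of _ = \<lparr>carrier = UNIV, vadd = (+), vzero = 0, vscale = scaleC, vnorm = norm\<rparr>"

text \<open>The infimum is taken in the extended reals, so that it is \<open>\<infinity>\<close> over the empty set
  (which occurs for the zero space).\<close>

definition uniformly_convex :: "'v cspace \<Rightarrow> bool" where
  "uniformly_convex V \<longleftrightarrow>
     (\<forall>e. 0 < e \<and> e < 2 \<longrightarrow>
       (INF (x, y) \<in> {(x, y). x \<in> carrier V \<and> y \<in> carrier V \<and> vnorm V x \<le> 1 \<and> vnorm V y \<le> 1
                             \<and> e \<le> vnorm V (vdiff V x y)}.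
          ereal (1 - vnorm V (vadd V x y) / 2)) > 0)"

definition smoothness_modulus :: "'v cspace \<Rightarrow> real \<Rightarrow> real" where
  "smoothness_modulus V t =
     (SUP (x, y) \<in> {(x, y). x \<in> carrier V \<and> y \<in> carrier V \<and> vnorm V x \<le> 1 \<and> vnorm V y \<le> t}.
        (vnorm V (vadd V x y) + vnorm V (vdiff V x y)) / 2 - 1)"

definition uniformly_smooth :: "'v cspace \<Rightarrow> bool" where
  "uniformly_smooth V \<longleftrightarrow> ((\<lambda>t. smoothness_modulus V t / t) \<longlongrightarrow> 0) (at_right 0)"

definition isomorphic_spaces :: "'v cspace \<Rightarrow> 'w cspace \<Rightarrow> bool" where
  "isomorphic_spaces V W \<longleftrightarrow>
     (\<exists>T. bij_betw T (carrier V) (carrier W)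
        \<and> (\<forall>x\<in>carrier V. \<forall>y\<in>carrier V. T (vadd V x y) = vadd W (T x) (T y))
        \<and> (\<forall>c. \<forall>x\<in>carrier V. T (vscale V c x) = vscale W c (T x))
        \<and> (\<exists>K. \<forall>x\<in>carrier V. vnorm W (T x) \<le> K * vnorm V x)
        \<and> (\<exists>K. \<forall>x\<in>carrier V. vnorm V x \<le> K * vnorm W (T x)))"

text \<open>An isomorphic space has the cardinality of \<open>V\<close>, so taking its elements from the same type
  is no restriction.\<close>

definition superreflexive :: "'v cspace \<Rightarrow> bool" where
  "superreflexive V \<longleftrightarrow>
     (\<exists>W :: 'v cspace. complex_banach_space W \<and> uniformly_convex W \<and> uniformly_smooth W
        \<and> isomorphic_spaces V W)"

text \<open>The quotient by a closed subspace \<open>M\<close>: its elements are the cosets of \<open>M\<close>. Adding \<open>M\<close> after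
  scaling matters only for the scalar \<open>0\<close>.\<close>

definition quotient_space :: "'b::complex_banach set \<Rightarrow> 'b set cspace" where
  "quotient_space M =
     \<lparr>carrier = {{x + m | m. m \<in> M} | x. True},
      vadd = (\<lambda>C D. {x + y | x y. x \<in> C \<and> y \<in> D}),
      vzero = M,
      vscale = (\<lambda>c C. {c *\<^sub>C x + m | x m. x \<in> C \<and> m \<in> M}),
      vnorm = (\<lambda>C. INF x\<in>C. norm x)\<rparr>"


subsection \<open>Isometric representations and affine isometric actions of discrete groups\<close>

definition isometry_group :: "('b::complex_banach \<Rightarrow> 'b) monoid" where
  "isometry_group =
     \<lparr>carrier = {f. Vector_Spaces.linear scaleC scaleC f \<and> surj f \<and> (\<forall>x. norm (f x) = norm x)},
      monoid.mult = (\<circ>), one = id\<rparr>"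

definition isometric_representation ::
    "'g monoid \<Rightarrow> ('g \<Rightarrow> 'b::complex_banach \<Rightarrow> 'b) \<Rightarrow> bool" where
  "isometric_representation G \<rho> \<longleftrightarrow> \<rho> \<in> hom G isometry_group"

definition invariant_vectors :: "('g \<Rightarrow> 'b \<Rightarrow> 'b) \<Rightarrow> 'g set \<Rightarrow> 'b set" where
  "invariant_vectors \<rho> N = {\<xi>. \<forall>n\<in>N. \<rho> n \<xi> = \<xi>}"

text \<open>Compact subsets of a discrete group are the finite ones.\<close>

definition almost_invariant_vectors ::
    "'g monoid \<Rightarrow> 'v cspace \<Rightarrow> ('g \<Rightarrow> 'v \<Rightarrow> 'v) \<Rightarrow> bool" where
  "almost_invariant_vectors G E \<rho> \<longleftrightarrow>
     (\<forall>F e. finite F \<and> F \<subseteq> carrier G \<and> 0 < e \<longrightarrow>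
       (\<exists>\<xi>\<in>carrier E. vnorm E \<xi> = 1 \<and> (\<forall>s\<in>F. vnorm E (vdiff E (\<rho> s \<xi>) \<xi>) \<le> e)))"

text \<open>In the next two definitions the type argument is the Banach space. A linear map induces on
  cosets its image map.\<close>

definition relative_T :: "'g monoid \<Rightarrow> 'g set \<Rightarrow> 'b::complex_banach itself \<Rightarrow> bool" where
  "relative_T G N _ \<longleftrightarrow>
     (\<forall>\<rho> :: 'g \<Rightarrow> 'b \<Rightarrow> 'b. isometric_representation G \<rho> \<longrightarrow>
       \<not> almost_invariant_vectors G (quotient_space (invariant_vectors \<rho> N)) (\<lambda>g C. \<rho> g ` C))"

definition affine_isometric_action ::
    "'g monoid \<Rightarrow> ('g \<Rightarrow> 'b::complex_banach \<Rightarrow> 'b) \<Rightarrow> bool" where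
  "affine_isometric_action G \<alpha> \<longleftrightarrow>
     group_action G UNIV \<alpha> \<and>
     (\<exists>\<rho> c. isometric_representation G \<rho> \<and> (\<forall>g\<in>carrier G. \<forall>\<xi>. \<alpha> g \<xi> = \<rho> g \<xi> + c g))"

definition relative_F :: "'g monoid \<Rightarrow> 'g set \<Rightarrow> 'b::complex_banach itself \<Rightarrow> bool" where
  "relative_F G N _ \<longleftrightarrow>
     (\<forall>\<alpha> :: 'g \<Rightarrow> 'b \<Rightarrow> 'b. affine_isometric_action G \<alpha> \<longrightarrow> (\<exists>\<xi>. \<forall>n\<in>N. \<alpha> n \<xi> = \<xi>))"

end

theory Submission
  imports Defs
begin

text \<open>Write \<open>A\<close> for the coefficient ring, \<open>N = A\<^sup>3\<close> for the translations, and let \<open>c\<close> be the cocycle of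
  an affine isometric action of \<open>SL\<^sub>3(A) \<ltimes> A\<^sup>3\<close> with linear part \<open>\<rho>\<close>. In a superreflexive space an
  affine isometric group action with a bounded orbit fixes the circumcentre of that orbit
  (\<open>fixed_point_of_bounded_orbit\<close>), so it suffices to bound \<open>c\<close> on \<open>N\<close>. Conjugating by permutation
  matrices, one need only bound \<open>c(z)\<close> for \<open>z\<close> a translation along the third coordinate.

  Such a \<open>z\<close> is centralised by two copies of \<open>EL\<^sub>2(A) \<ltimes> A\<^sup>2\<close>: in one, the normal subgroup \<open>A\<^sup>2\<close>
  consists of the translations along the first two coordinates; in the other, of the matrices that
  add multiples of the first two coordinates to the third. Commuting with \<open>z\<close> forces an element \<open>s\<close>
  to move \<open>c(z)\<close> by at most \<open>2 \<parallel>c(s)\<parallel>\<close>, which does not depend on \<open>z\<close>. Applied to the finite set of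
  the spectral gap given by relative property (T), this bounds, uniformly in \<open>z\<close>, how far either
  copy of \<open>A\<^sup>2\<close> moves \<open>c(z)\<close>. Every translation is a product of boundedly many elements of the
  two copies, because their commutators are the translations along the third coordinate. Hence
  all of \<open>N\<close> moves \<open>c(z)\<close> by at most a constant (\<open>last_coordinate_displacement\<close>), and by the
  circumcentre argument for the linear action \<open>\<rho>\<close>, \<open>c(z)\<close> is within a constant \<open>E\<close> of some
  \<open>\<rho>(N)\<close>-invariant vector \<open>y\<close>.

  It remains to bound \<open>y\<close>. Since \<open>y\<close> is invariant, \<open>c(z\<^sup>m)\<close> is within \<open>m E\<close> of \<open>m y\<close>. On the other
  hand \<open>z\<close> is distorted: \<open>z\<close> raised to the power \<open>p q\<close> is the product of two translations by \<open>q\<close> along the second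
  coordinate, one of them conjugated by a matrix that depends on \<open>p\<close> only. So some power has
  \<open>\<parallel>c(z\<^sup>m)\<parallel> \<le> m\<close> (\<open>last_coordinate_slow_growth\<close>), which gives \<open>\<parallel>y\<parallel> \<le> E + 1\<close>.\<close>

section \<open>Uniformly convex renorming and circumcentres\<close>

text \<open>The norm provided by superreflexivity, transported to the original space: it is equivalent to the
  given norm but need not be preserved by the isometries of the given norm.\<close>

locale uniformly_convex_norm =
  fixes p :: "'b::real_normed_vector \<Rightarrow> real" and a b :: real
  assumes a_pos: "0 < a"
    and b_pos: "0 < b"
    and triangle: "p (x + y) \<le> p x + p y"
    and scale: "p (r *\<^sub>R x) = \<bar>r\<bar> * p x"
    and lower: "a * norm x \<le> p x"
    and upper: "p x \<le> b * norm x"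
    and convex_unit: "0 < e \<Longrightarrow>
      \<exists>d>0. \<forall>x y. p x \<le> 1 \<and> p y \<le> 1 \<and> e \<le> p (x - y) \<longrightarrow> p ((1/2) *\<^sub>R (x + y)) \<le> 1 - d"
begin

lemma nonneg: "0 \<le> p x"
  using lower[of x] a_pos by (meson order_trans norm_ge_zero mult_nonneg_nonneg less_imp_le)

text \<open>The convexity condition at scale \<open>r\<close>, by homogeneity.\<close>

lemma convex:
  assumes "0 < e"
  obtains d where "0 < d"
    and "\<And>r x y. \<lbrakk>0 < r; p x \<le> r; p y \<le> r; e * r \<le> p (x - y)\<rbrakk>
           \<Longrightarrow> p ((1/2) *\<^sub>R (x + y)) \<le> r * (1 - d)"
proof -
  obtain d where d: "0 < d" "\<And>x y. \<lbrakk>p x \<le> 1; p y \<le> 1; e \<le> p (x - y)\<rbrakk> \<Longrightarrow>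
      p ((1/2) *\<^sub>R (x + y)) \<le> 1 - d"
    using convex_unit[OF assms] by blast
  have "p ((1/2) *\<^sub>R (x + y)) \<le> r * (1 - d)"
    if "0 < r" "p x \<le> r" "p y \<le> r" "e * r \<le> p (x - y)" for r x y
  proof -
    have "p ((1/2) *\<^sub>R ((1/r) *\<^sub>R x + (1/r) *\<^sub>R y)) \<le> 1 - d"
    proof (rule d(2))
      show "p ((1/r) *\<^sub>R x) \<le> 1" "p ((1/r) *\<^sub>R y) \<le> 1"
        using that by (simp_all add: scale divide_simps)
      show "e \<le> p ((1/r) *\<^sub>R x - (1/r) *\<^sub>R y)"
        using that by (simp add: scale scaleR_diff_right[symmetric] divide_simps)
    qed
    moreover have "(1/2) *\<^sub>R ((1/r) *\<^sub>R x + (1/r) *\<^sub>R y) = (1/r) *\<^sub>R ((1/2) *\<^sub>R (x + y))"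
      by (simp add: scaleR_add_right mult.commute)
    ultimately have "(1/r) * p ((1/2) *\<^sub>R (x + y)) \<le> 1 - d"
      using \<open>0 < r\<close> by (simp only: scale) simp
    then show ?thesis using \<open>0 < r\<close> by (simp add: field_simps)
  qed
  then show thesis using d(1) that by blast
qed

end

lemma superreflexive_uniformly_convex_norm:
  assumes "superreflexive (space_of TYPE('b::complex_banach))"
  obtains p :: "'b::complex_banach \<Rightarrow> real" and a b where "uniformly_convex_norm p a b"
proof -
  obtain W :: "'b cspace" where W: "complex_banach_space W" "uniformly_convex W"
    and iso: "isomorphic_spaces (space_of TYPE('b)) W"
    using assms unfolding superreflexive_def by blast
  have "\<exists>T :: 'b \<Rightarrow> 'b. bij_betw T UNIV (carrier W)
      \<and> (\<forall>x y. T (x + y) = vadd W (T x) (T y))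
      \<and> (\<forall>c x. T (c *\<^sub>C x) = vscale W c (T x))
      \<and> (\<exists>K. \<forall>x. vnorm W (T x) \<le> K * norm x)
      \<and> (\<exists>L. \<forall>x. norm x \<le> L * vnorm W (T x))"
    using iso unfolding isomorphic_spaces_def space_of_def by simp
  then obtain T :: "'b \<Rightarrow> 'b" where T_bij: "bij_betw T UNIV (carrier W)"
    and T_add: "\<forall>x y. T (x + y) = vadd W (T x) (T y)"
    and T_scale: "\<forall>c x. T (c *\<^sub>C x) = vscale W c (T x)"
    and T_bounded: "\<exists>K. \<forall>x. vnorm W (T x) \<le> K * norm x" "\<exists>L. \<forall>x. norm x \<le> L * vnorm W (T x)"
    by - (erule exE, elim conjE, rule that)
  obtain K where K: "\<forall>x. vnorm W (T x) \<le> K * norm x" using T_bounded(1) by (rule exE)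
  obtain L where L: "\<forall>x. norm x \<le> L * vnorm W (T x)" using T_bounded(2) by (rule exE)
  interpret W: complex_normed_space W using W(1) by (simp add: complex_banach_space_def)
  have TW [simp]: "T x \<in> carrier W" for x using T_bij by (auto simp: bij_betw_def)
  define p where "p x = vnorm W (T x)" for x
  have T_diff: "T (x - y) = vdiff W (T x) (T y)" for x y
  proof -
    have "(-1) *\<^sub>C y = - y" using scaleC_of_real[of "-1" y] by simp
    then show ?thesis using T_add[rule_format, of x "- y"] T_scale[rule_format, of "-1" y] by (simp add: vdiff_def)
  qed
  have p_nonneg: "0 \<le> p x" for x by (simp add: p_def W.vnorm_nonneg)
  have p_scaleC: "p (c *\<^sub>C x) = cmod c * p x" for c x by (simp add: p_def T_scale W.vnorm_vscale)
  have p_scaleR: "p (r *\<^sub>R x) = \<bar>r\<bar> * p x" for r x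
    using p_scaleC[of "complex_of_real r" x] by (simp add: scaleC_of_real)
  have "uniformly_convex_norm p (1 / max L 1) (max K 1)"
  proof
    show "p (x + y) \<le> p x + p y" for x y by (simp add: p_def T_add W.vnorm_triangle)
    show "p (r *\<^sub>R x) = \<bar>r\<bar> * p x" for r x by (rule p_scaleR)
    have "norm x \<le> max L 1 * p x" for x
      using L[rule_format, of x] p_nonneg[of x] mult_right_mono[of L "max L 1" "p x"]
      by (simp add: p_def)
    then show "1 / max L 1 * norm x \<le> p x" for x
      by (simp add: divide_le_eq mult.commute)
    show "p x \<le> max K 1 * norm x" for x
      using K[rule_format, of x] mult_right_mono[of K "max K 1" "norm x"] by (simp add: p_def)
    \<comment> \<open>Uniform convexity is only given for separations below 2; a larger separation implies a smaller one.\<close>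
    fix e :: real assume "0 < e"
    define e' where "e' = min e 1"
    have e': "0 < e'" "e' < 2" "e' \<le> e" using \<open>0 < e\<close> by (auto simp: e'_def)
    let ?S = "{(x, y). x \<in> carrier W \<and> y \<in> carrier W \<and> vnorm W x \<le> 1 \<and> vnorm W y \<le> 1
                             \<and> e' \<le> vnorm W (vdiff W x y)}"
    let ?I = "INF (x, y) \<in> ?S. ereal (1 - vnorm W (vadd W x y) / 2)"
    have "0 < ?I" using W(2) e' unfolding uniformly_convex_def by blast
    then obtain d where d: "0 < ereal d" "ereal d < ?I"
      using ereal_dense2 by blast
    have "p ((1/2) *\<^sub>R (x + y)) \<le> 1 - d" if "p x \<le> 1" "p y \<le> 1" "e \<le> p (x - y)" for x y
    proof -
      have "(T x, T y) \<in> ?S" using that e' by (auto simp: p_def T_diff)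
      then have "?I \<le> ereal (1 - vnorm W (vadd W (T x) (T y)) / 2)"
        by (rule INF_lower2) simp
      with d(2) have "ereal d < ereal (1 - vnorm W (vadd W (T x) (T y)) / 2)"
        by (rule less_le_trans)
      then have "d < 1 - p (x + y) / 2" by (simp add: p_def T_add)
      then show ?thesis by (simp add: p_scaleR)
    qed
    then show "\<exists>d>0. \<forall>x y. p x \<le> 1 \<and> p y \<le> 1 \<and> e \<le> p (x - y) \<longrightarrow> p ((1/2) *\<^sub>R (x + y)) \<le> 1 - d"
      using d(1) by auto
  qed auto
  then show thesis by (rule that)
qed

section \<open>Isometric representations and cocycles\<close>

lemma isometric_representationD:
  assumes "isometric_representation G \<rho>" and "g \<in> carrier G"
  shows "\<rho> g (x + y) = \<rho> g x + \<rho> g y"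
    and "\<rho> g (x - y) = \<rho> g x - \<rho> g y"
    and "\<rho> g (z *\<^sub>C x) = z *\<^sub>C \<rho> g x"
    and "\<rho> g (r *\<^sub>R x) = r *\<^sub>R \<rho> g x"
    and "norm (\<rho> g x) = norm x"
    and "h \<in> carrier G \<Longrightarrow> \<rho> (g \<otimes>\<^bsub>G\<^esub> h) x = \<rho> g (\<rho> h x)"
proof -
  have rho: "\<rho> g \<in> carrier isometry_group"
    using assms by (auto simp: isometric_representation_def hom_def)
  then show add: "\<rho> g (x + y) = \<rho> g x + \<rho> g y" and scaleC: "\<rho> g (z *\<^sub>C x) = z *\<^sub>C \<rho> g x"
    and "norm (\<rho> g x) = norm x" for x y z
    by (auto simp: isometry_group_def Vector_Spaces.linear_iff)
  show "\<rho> g (x - y) = \<rho> g x - \<rho> g y"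
    using add[of "x - y" y] by simp
  show "\<rho> g (r *\<^sub>R x) = r *\<^sub>R \<rho> g x"
    using scaleC[of "complex_of_real r" x] by (simp add: scaleC_of_real)
  show "\<rho> (g \<otimes>\<^bsub>G\<^esub> h) x = \<rho> g (\<rho> h x)" if "h \<in> carrier G"
    using assms that by (auto simp: isometric_representation_def hom_def isometry_group_def)
qed


locale isometric_cocycle = group G for G :: "'g monoid" (structure) +
  fixes \<rho> :: "'g \<Rightarrow> 'b::complex_banach \<Rightarrow> 'b" and c :: "'g \<Rightarrow> 'b"
  assumes rep: "isometric_representation G \<rho>"
    and cocycle: "\<lbrakk>g \<in> carrier G; h \<in> carrier G\<rbrakk> \<Longrightarrow> c (g \<otimes> h) = c g + \<rho> g (c h)"
begin

lemmas rho = isometric_representationD[OF rep]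

lemma rho_one: "\<rho> \<one> x = x"
proof -
  have "\<rho> \<one> (\<rho> \<one> x - x) = 0"
    using rho(6)[of \<one> \<one> x] by (simp add: rho(2))
  then show ?thesis using rho(5)[of \<one> "\<rho> \<one> x - x"] by simp
qed

lemma cocycle_one: "c \<one> = 0"
  using cocycle[of \<one> \<one>] by (simp add: rho_one)

text \<open>The fixed point is the circumcentre of the orbit of \<open>x\<close>. The radius \<open>R y\<close> that it minimises is measured
  from the whole orbit of \<open>y\<close> to the whole orbit of \<open>x\<close>, so that \<open>R\<close> is constant on orbits although
  \<open>p\<close> is not invariant. Uniqueness of the minimiser survives: the action preserves the given norm,
  hence the points \<open>act n y\<close> and \<open>act n y'\<close> are \<open>p\<close>-separated by at least \<open>a * norm (y - y')\<close> for every
  \<open>n\<close>, and uniform convexity makes all distances from their midpoint smaller by a common factor.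
  Used with \<open>c = 0\<close>, the lemma yields an invariant vector near an almost invariant one, and
  the estimate says how near.\<close>

lemma fixed_point_of_bounded_orbit:
  assumes "uniformly_convex_norm (p :: 'b \<Rightarrow> real) a b" and N: "subgroup N G"
    and bounded: "\<And>n. n \<in> N \<Longrightarrow> norm (\<rho> n x + c n - x) \<le> D"
  obtains z where "\<And>n. n \<in> N \<Longrightarrow> \<rho> n z + c n = z" and "norm (z - x) \<le> 2 * b / a * D"
proof -
  interpret p: uniformly_convex_norm p a b by fact
  have NG: "n \<in> carrier G" if "n \<in> N" for n using N that by (rule subgroup.mem_carrier)
  have N_one: "\<one> \<in> N" using N by (rule subgroup.one_closed)
  have N_mult: "m \<otimes> n \<in> N" if "m \<in> N" "n \<in> N" for m n using N that by (rule subgroup.m_closed)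
  define act where "act n y = \<rho> n y + c n" for n y
  have act_mult: "act (m \<otimes> n) y = act m (act n y)" if "m \<in> N" "n \<in> N" for m n y
    using that NG by (simp add: act_def cocycle rho(1,6))
  have act_one: "act \<one> y = y" for y by (simp add: act_def rho_one cocycle_one)
  have act_dist: "norm (act n y - act n y') = norm (y - y')" if "n \<in> N" for n y y'
    using that NG by (simp add: act_def rho(2)[symmetric] rho(5))
  have act_mid: "act n ((1/2) *\<^sub>R (y + y')) = (1/2) *\<^sub>R (act n y + act n y')" if "n \<in> N" for n y y'
  proof -
    have "c n = (1/2) *\<^sub>R (c n + c n)" by (simp add: scaleR_2[symmetric])
    then have "act n ((1/2) *\<^sub>R (y + y')) = (1/2) *\<^sub>R (\<rho> n y + \<rho> n y') + (1/2) *\<^sub>R (c n + c n)"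
      using that NG by (simp add: act_def rho(1,4))
    also have "\<dots> = (1/2) *\<^sub>R (act n y + act n y')"
      by (simp add: act_def algebra_simps)
    finally show ?thesis .
  qed
  have p_minus: "p (y - y') = p (y' - y)" for y y'
    using p.scale[of "-1" "y - y'"] by simp
  have orbit_dist: "norm (act m x - act n y) \<le> 2 * D + norm (y - x)" if "m \<in> N" "n \<in> N" for m n y
  proof -
    have "norm (act m x - act n y) \<le> norm (act m x - x) + norm (act n x - x) + norm (act n x - act n y)"
      by norm
    then show ?thesis
      using bounded[OF that(1)] bounded[OF that(2)] act_dist[OF that(2), of x y]
      by (simp add: act_def norm_minus_commute)
  qed
  define R where "R y = (SUP (m, n) \<in> N \<times> N. p (act m x - act n y))" for y
  have orbit_p: "p (act m x - act n y) \<le> b * (2 * D + norm (y - x))" if "m \<in> N" "n \<in> N" for m n y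
    using p.upper[of "act m x - act n y"] orbit_dist[OF that, of y] p.b_pos
    by (meson mult_left_mono less_imp_le order_trans)
  have R_upper: "p (act m x - act n y) \<le> R y" if "m \<in> N" "n \<in> N" for m n y
    unfolding R_def
    by (rule cSUP_upper2[where x = "(m, n)"])
       (use that orbit_p in \<open>auto intro!: bdd_aboveI2[where M = "b * (2 * D + norm (y - x))"]\<close>)
  have R_least: "R y \<le> r" if "\<And>m n. \<lbrakk>m \<in> N; n \<in> N\<rbrakk> \<Longrightarrow> p (act m x - act n y) \<le> r" for y r
    unfolding R_def by (rule cSUP_least) (use N_one that in auto)
  have R_p: "p (x - y) \<le> R y" for y
    using R_upper[OF N_one N_one, of y] by (simp add: act_one)
  have R_nonneg: "0 \<le> R y" for y using R_p[of y] p.nonneg[of "x - y"] by simp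
  have R_lipschitz: "R y \<le> R y' + b * norm (y - y')" for y y'
  proof (rule R_least)
    fix m n assume mn: "m \<in> N" "n \<in> N"
    have "p (act m x - act n y) \<le> p (act m x - act n y') + p (act n y' - act n y)"
      using p.triangle[of "act m x - act n y'" "act n y' - act n y"] by simp
    also have "p (act n y' - act n y) \<le> b * norm (y - y')"
      using p.upper[of "act n y' - act n y"] act_dist[OF mn(2), of y' y] by (simp add: norm_minus_commute)
    finally show "p (act m x - act n y) \<le> R y' + b * norm (y - y')"
      using R_upper[OF mn, of y'] by simp
  qed
  \<comment> \<open>Near-minimisers of \<open>R\<close> are close to each other, so a minimising sequence converges.\<close>
  define r0 where "r0 = (INF y. R y)"
  have r0_le: "r0 \<le> R y" for y
    unfolding r0_def by (rule cINF_lower) (use R_nonneg in \<open>auto intro: bdd_belowI2[where m = 0]\<close>)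
  have r0_nonneg: "0 \<le> r0" unfolding r0_def by (rule cINF_greatest) (use R_nonneg in auto)
  have near_minimisers: "\<exists>s>0. \<forall>y y'. R y \<le> r0 + s \<and> R y' \<le> r0 + s \<longrightarrow> norm (y - y') < \<delta>"
    if "0 < \<delta>" for \<delta>
  proof (cases "r0 = 0")
    case True
    have "norm (y - y') < \<delta>" if "R y \<le> r0 + a * \<delta> / 4" "R y' \<le> r0 + a * \<delta> / 4" for y y'
    proof -
      have "a * norm (y - y') \<le> p (y - x) + p (x - y')"
        using p.lower[of "y - y'"] p.triangle[of "y - x" "x - y'"] by simp
      also have "\<dots> \<le> a * \<delta> / 4 + a * \<delta> / 4"
        using R_p[of y] R_p[of y'] that True unfolding p_minus[of y x] by linarith
      also have "\<dots> < a * \<delta>" using p.a_pos \<open>0 < \<delta>\<close> by simp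
      finally show ?thesis using p.a_pos by simp
    qed
    then show ?thesis using p.a_pos \<open>0 < \<delta>\<close> by (intro exI[of _ "a * \<delta> / 4"]) auto
  next
    case False
    then have r0: "0 < r0" using r0_nonneg by simp
    then have "0 < a * \<delta> / (2 * r0)" using p.a_pos \<open>0 < \<delta>\<close> by simp
    then obtain d where d: "0 < d" "\<And>r y y'. \<lbrakk>0 < r; p y \<le> r; p y' \<le> r; a * \<delta> / (2 * r0) * r \<le> p (y - y')\<rbrakk>
           \<Longrightarrow> p ((1/2) *\<^sub>R (y + y')) \<le> r * (1 - d)"
      using p.convex by metis
    \<comment> \<open>The midpoint of two far apart near-minimisers would have radius at most \<open>(r0 + s) * (1 - d)\<close>,
        which this choice of \<open>s\<close> makes less than the infimum \<open>r0\<close>.\<close>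
    define s where "s = min r0 (r0 * d / 2)"
    have s: "0 < s" "s \<le> r0" "s < r0 * d" using r0 d(1) by (auto simp: s_def min_less_iff_disj)
    have "norm (y - y') < \<delta>" if y: "R y \<le> r0 + s" "R y' \<le> r0 + s" for y y'
    proof (rule ccontr)
      assume "\<not> norm (y - y') < \<delta>"
      then have far: "\<delta> \<le> norm (y - y')" by simp
      have "R ((1/2) *\<^sub>R (y + y')) \<le> (r0 + s) * (1 - d)"
      proof (rule R_least)
        fix m n assume mn: "m \<in> N" "n \<in> N"
        have "a * \<delta> / (2 * r0) * (r0 + s) \<le> a * \<delta> / (2 * r0) * (2 * r0)"
          using s r0 p.a_pos \<open>0 < \<delta>\<close> by (intro mult_left_mono) auto
        also have "\<dots> = a * \<delta>" using r0 by simp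
        also have "\<dots> \<le> a * norm (act n y' - act n y)"
          using far p.a_pos act_dist[OF mn(2), of y' y] by (simp add: norm_minus_commute)
        also have "\<dots> \<le> p ((act m x - act n y) - (act m x - act n y'))"
          using p.lower[of "act n y' - act n y"] by simp
        finally have "p ((1/2) *\<^sub>R ((act m x - act n y) + (act m x - act n y'))) \<le> (r0 + s) * (1 - d)"
          using r0 s R_upper[OF mn, of y] R_upper[OF mn, of y'] y by (intro d(2)) auto
        moreover have "act m x - act n ((1/2) *\<^sub>R (y + y')) =
            (1/2) *\<^sub>R ((act m x - act n y) + (act m x - act n y'))"
        proof -
          have "act m x = (1/2) *\<^sub>R (act m x + act m x)" by (simp add: scaleR_2[symmetric])
          then have "act m x - act n ((1/2) *\<^sub>R (y + y')) =
              (1/2) *\<^sub>R (act m x + act m x) - (1/2) *\<^sub>R (act n y + act n y')"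
            by (simp add: act_mid[OF mn(2)])
          then show ?thesis by (simp add: algebra_simps)
        qed
        ultimately show "p (act m x - act n ((1/2) *\<^sub>R (y + y'))) \<le> (r0 + s) * (1 - d)" by simp
      qed
      also have "\<dots> < r0"
        using s(3) mult_pos_pos[OF s(1) d(1)] by (simp add: ring_distribs)
      finally show False using r0_le[of "(1/2) *\<^sub>R (y + y')"] by simp
    qed
    then show ?thesis using s(1) by blast
  qed
  have "\<exists>y. R y < r0 + inverse (real (Suc k))" for k
    using cInf_lessD[of "range R" "r0 + inverse (real (Suc k))"] by (auto simp: r0_def)
  then obtain y where y: "\<And>k. R (y k) < r0 + inverse (real (Suc k))" by metis
  have "Cauchy y"
  proof (rule CauchyI)
    fix \<delta> :: real assume "0 < \<delta>"
    then obtain s where s: "0 < s" "\<And>y y'. \<lbrakk>R y \<le> r0 + s; R y' \<le> r0 + s\<rbrakk> \<Longrightarrow> norm (y - y') < \<delta>"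
      using near_minimisers by blast
    obtain k0 where k0: "inverse (real (Suc k0)) < s" using reals_Archimedean[OF s(1)] by blast
    have "R (y k) \<le> r0 + s" if "k0 \<le> k" for k
    proof -
      have "inverse (real (Suc k)) \<le> inverse (real (Suc k0))" using that by (simp add: field_simps)
      then show ?thesis using y[of k] k0 by linarith
    qed
    then show "\<exists>M. \<forall>m\<ge>M. \<forall>n\<ge>M. norm (y m - y n) < \<delta>" using s(2) by blast
  qed
  then obtain z where z: "y \<longlonglongrightarrow> z" by (auto simp: Cauchy_convergent_iff convergent_def)
  have limit: "(\<lambda>k. r0 + inverse (real (Suc k)) + b * norm (z - y k)) \<longlonglongrightarrow> r0 + 0 + b * norm (z - z)"
    by (intro tendsto_intros LIMSEQ_inverse_real_of_nat z)
  have "R z \<le> r0 + inverse (real (Suc k)) + b * norm (z - y k)" for k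
    using R_lipschitz[of z "y k"] y[of k] by linarith
  then have "R z \<le> r0 + 0 + b * norm (z - z)"
    by (rule LIMSEQ_le_const[OF limit, OF exI, OF allI, OF impI])
  then have Rz: "R z \<le> r0" by simp
  show thesis
  proof
    fix n assume n: "n \<in> N"
    have "R (act n z) \<le> R z"
    proof (rule R_least)
      fix m m' assume "m \<in> N" "m' \<in> N"
      then show "p (act m x - act m' (act n z)) \<le> R z"
        using R_upper[of m "m' \<otimes> n" z] n N_mult by (simp add: act_mult)
    qed
    then have "R (act n z) \<le> r0" using Rz by simp
    then have "norm (act n z - z) < \<delta>" if "0 < \<delta>" for \<delta>
      using near_minimisers[OF that] Rz by (meson less_add_same_cancel1 less_imp_le order_trans)
    then have "act n z = z"
      by (metis less_irrefl zero_less_norm_iff right_minus_eq)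
    then show "\<rho> n z + c n = z" by (simp add: act_def)
  next
    have "a * norm (z - x) \<le> p (z - x)" by (rule p.lower)
    also have "\<dots> \<le> R x" using R_p[of z] Rz r0_le[of x] by (simp add: p_minus[of z x])
    also have "\<dots> \<le> b * (2 * D)" by (rule R_least) (use orbit_p[of _ _ x] in simp)
    finally show "norm (z - x) \<le> 2 * b / a * D" using p.a_pos by (simp add: field_simps)
  qed
qed

lemma norm_cocycle_mult:
  assumes "g \<in> carrier G" "h \<in> carrier G"
  shows "norm (c (g \<otimes> h)) \<le> norm (c g) + norm (c h)"
  using norm_triangle_ineq[of "c g" "\<rho> g (c h)"] assms by (simp add: cocycle rho(5))

lemma norm_cocycle_inv:
  assumes "g \<in> carrier G"
  shows "norm (c (inv g)) = norm (c g)"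
proof -
  have "c g + \<rho> g (c (inv g)) = 0" using cocycle[of g "inv g"] assms by (simp add: cocycle_one)
  then have "c g = - \<rho> g (c (inv g))" by (simp add: add_eq_0_iff2)
  then show ?thesis using assms by (simp add: rho(5))
qed

text \<open>The relation \<open>h' = g h g\<inverse>\<close> is stated without inverses, as it is checked in this form for matrices.\<close>

lemma norm_cocycle_conj:
  assumes g: "g \<in> carrier G" and h: "h \<in> carrier G" and h': "h' \<in> carrier G"
    and "g \<otimes> h = h' \<otimes> g"
  shows "norm (c h') \<le> norm (c h) + 2 * norm (c g)"
proof -
  have "h' = g \<otimes> h \<otimes> inv g" using assms by (simp add: inv_solve_right)
  then show ?thesis
    using norm_cocycle_mult[of "g \<otimes> h" "inv g"] norm_cocycle_mult[OF g h] norm_cocycle_inv[OF g] g h by simp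
qed

lemma displacement_mult:
  assumes "g \<in> carrier G" "h \<in> carrier G"
  shows "norm (\<rho> (g \<otimes> h) x - x) \<le> norm (\<rho> g x - x) + norm (\<rho> h x - x)"
proof -
  have eq: "\<rho> (g \<otimes> h) x - x = \<rho> g (\<rho> h x - x) + (\<rho> g x - x)" using assms by (simp add: rho(2,6))
  show ?thesis unfolding eq using norm_triangle_ineq[of "\<rho> g (\<rho> h x - x)" "\<rho> g x - x"] assms
    by (simp add: rho(5))
qed

lemma displacement_conj:
  assumes g: "g \<in> carrier G" and h: "h \<in> carrier G" and h': "h' \<in> carrier G"
    and eq: "g \<otimes> h = h' \<otimes> g"
  shows "norm (\<rho> h' x - x) \<le> norm (\<rho> h x - x) + 2 * norm (\<rho> g x - x)"
proof -
  have "\<rho> h' (\<rho> g x) = \<rho> g (\<rho> h x)" using rho(6)[OF g h, of x] rho(6)[OF h' g, of x] eq by simp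
  then have eq: "\<rho> h' x - x = \<rho> h' (x - \<rho> g x) + \<rho> g (\<rho> h x - x) + (\<rho> g x - x)"
    using assms by (simp add: rho(2))
  have "norm (\<rho> h' x - x) \<le> norm (\<rho> h' (x - \<rho> g x)) + norm (\<rho> g (\<rho> h x - x)) + norm (\<rho> g x - x)"
    unfolding eq using norm_triangle_ineq[of "\<rho> h' (x - \<rho> g x)" "\<rho> g (\<rho> h x - x)"]
      norm_triangle_ineq[of "\<rho> h' (x - \<rho> g x) + \<rho> g (\<rho> h x - x)" "\<rho> g x - x"]
    by linarith
  then show ?thesis using assms by (simp add: rho(5) norm_minus_commute)
qed

text \<open>Both \<open>c (s \<otimes> z)\<close> and \<open>c (z \<otimes> s)\<close> can be expanded by the cocycle identity, which gives
  \<open>\<rho> s (c z) - c z = \<rho> z (c s) - c s\<close>. The resulting bound is independent of \<open>z\<close>.\<close>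

lemma commuting_displacement:
  assumes s: "s \<in> carrier G" and z: "z \<in> carrier G" and "s \<otimes> z = z \<otimes> s"
  shows "norm (\<rho> s (c z) - c z) \<le> 2 * norm (c s)"
proof -
  have "c s + \<rho> s (c z) = c z + \<rho> z (c s)"
    using cocycle[OF s z] cocycle[OF z s] assms(3) by simp
  then have "\<rho> s (c z) - c z = \<rho> z (c s) - c s" by (simp add: algebra_simps)
  then show ?thesis using norm_triangle_ineq4[of "\<rho> z (c s)" "c s"] z by (simp add: rho(5))
qed

text \<open>By the cocycle identity \<open>c (z\<^sup>m)\<close> is the sum of the \<open>m\<close> vectors \<open>\<rho> (z\<^sup>i) (c z)\<close>, and each of them is as
  far from the invariant vector \<open>y\<close> as \<open>c z\<close> is.\<close>

lemma cocycle_pow_near: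
  assumes z: "z \<in> carrier G" and "\<rho> z y = y"
  shows "norm (c (z [^] m) - real m *\<^sub>R y) \<le> real m * norm (c z - y)"
proof (induction m)
  case 0
  then show ?case by (simp add: cocycle_one)
next
  case (Suc m)
  have "z [^] Suc m = z \<otimes> z [^] m" using z by (rule nat_pow_Suc2)
  then have "c (z [^] Suc m) - real (Suc m) *\<^sub>R y = (c z - y) + \<rho> z (c (z [^] m) - real m *\<^sub>R y)"
    using z assms(2) by (simp add: cocycle rho(2,4) algebra_simps)
  then have "norm (c (z [^] Suc m) - real (Suc m) *\<^sub>R y) \<le>
      norm (c z - y) + norm (c (z [^] m) - real m *\<^sub>R y)"
    using norm_triangle_ineq z by (metis rho(5))
  moreover have "real (Suc m) * norm (c z - y) = norm (c z - y) + real m * norm (c z - y)"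
    by (simp add: distrib_right)
  ultimately show ?case using Suc.IH by linarith
qed

end

section \<open>Relative property (T) as a displacement estimate\<close>

text \<open>If the finite set \<open>F\<close> and \<open>e\<close> witness the absence of almost invariant vectors modulo the space \<open>M\<close> of
  \<open>N\<close>-invariant vectors, then a vector moved by at most \<open>\<delta>\<close> by \<open>F\<close> lies at distance at most \<open>\<delta> / e\<close> from
  \<open>M\<close>, and elements of \<open>N\<close> move a vector by at most twice its distance from \<open>M\<close>. The
  displacement of a coset has quotient norm at most that of its representative \<open>\<pi> s x - x\<close>.\<close>

lemma relative_T_displacement:
  fixes \<pi> :: "'g \<Rightarrow> 'b::complex_banach \<Rightarrow> 'b"
  assumes T: "relative_T H N TYPE('b::complex_banach)"
    and rep: "isometric_representation H \<pi>" and "N \<subseteq> carrier H"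
  shows "\<exists>F K. finite F \<and> F \<subseteq> carrier H \<and>
    (\<forall>x \<delta>. 0 \<le> \<delta> \<longrightarrow> (\<forall>s\<in>F. norm (\<pi> s x - x) \<le> \<delta>) \<longrightarrow> (\<forall>n\<in>N. norm (\<pi> n x - x) \<le> K * \<delta>))"
proof -
  define M where "M = invariant_vectors \<pi> N"
  let ?V = "quotient_space M"
  have "\<not> almost_invariant_vectors H ?V (\<lambda>g C. \<pi> g ` C)"
    using T rep unfolding relative_T_def M_def by blast
  then obtain F e where F: "finite F" "F \<subseteq> carrier H" and e: "0 < e"
    and gap: "\<And>C. \<lbrakk>C \<in> carrier ?V; vnorm ?V C = 1\<rbrakk> \<Longrightarrow> \<exists>s\<in>F. e < vnorm ?V (vdiff ?V (\<pi> s ` C) C)"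
    unfolding almost_invariant_vectors_def by (metis linorder_not_le)
  note pi = isometric_representationD[OF rep]
  have NH: "n \<in> carrier H" if "n \<in> N" for n using that assms(3) by blast
  have M_scale: "r *\<^sub>R m \<in> M" if "m \<in> M" for r m
    using that NH by (auto simp: M_def invariant_vectors_def pi(4))
  have M_0: "0 \<in> M" using NH pi(4)[of _ 0 0] by (auto simp: M_def invariant_vectors_def)
  have "norm (\<pi> n x - x) \<le> 2 / e * \<delta>"
    if \<delta>: "0 \<le> \<delta>" and small: "\<And>s. s \<in> F \<Longrightarrow> norm (\<pi> s x - x) \<le> \<delta>" and n: "n \<in> N" for x \<delta> n
  proof -
    define d where "d = (INF m\<in>M. norm (x + m))"
    have d_lower: "d \<le> norm (x + m)" if "m \<in> M" for m
      unfolding d_def by (rule cINF_lower) (use that in \<open>auto intro: bdd_belowI2[where m = 0]\<close>)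
    have "d \<le> \<delta> / e"
    proof (rule ccontr)
      assume "\<not> d \<le> \<delta> / e"
      then have far: "\<delta> / e < d" by simp
      then have "0 < d" using \<delta> e by (meson divide_nonneg_pos le_less_trans)
      \<comment> \<open>Normalise \<open>x\<close> so that its coset has norm 1.\<close>
      define C where "C = {(1/d) *\<^sub>R x + m | m. m \<in> M}"
      have norm_C: "norm ((1/d) *\<^sub>R x + m) = norm (x + d *\<^sub>R m) / d" for m
      proof -
        have "(1/d) *\<^sub>R x + m = (1/d) *\<^sub>R (x + d *\<^sub>R m)" using \<open>0 < d\<close> by (simp add: scaleR_add_right)
        then show ?thesis using \<open>0 < d\<close> by simp
      qed
      have "(INF y\<in>C. norm y) = 1"
      proof (rule antisym)
        show "1 \<le> (INF y\<in>C. norm y)"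
        proof (rule cINF_greatest)
          show "C \<noteq> {}" using M_0 by (auto simp: C_def)
          fix y assume "y \<in> C"
          then obtain m where "m \<in> M" "y = (1/d) *\<^sub>R x + m" by (auto simp: C_def)
          then show "1 \<le> norm y" using d_lower[OF M_scale, of m d] \<open>0 < d\<close> by (simp add: norm_C)
        qed
        show "(INF y\<in>C. norm y) \<le> 1"
        proof (rule field_le_epsilon)
          fix \<epsilon> :: real assume "0 < \<epsilon>"
          then have "d < d * (1 + \<epsilon>)" using \<open>0 < d\<close> by simp
          then obtain m where m: "m \<in> M" "norm (x + m) < d * (1 + \<epsilon>)"
            using cInf_lessD[of "(\<lambda>m. norm (x + m)) ` M" "d * (1 + \<epsilon>)"] M_0 unfolding d_def by blast
          have "(INF y\<in>C. norm y) \<le> norm ((1/d) *\<^sub>R x + (1/d) *\<^sub>R m)"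
            by (rule cINF_lower)
               (use m M_scale in \<open>auto intro: bdd_belowI2[where m = 0] simp: C_def\<close>)
          also have "\<dots> = norm (x + m) / d" using \<open>0 < d\<close> by (simp add: norm_C)
          also have "\<dots> \<le> 1 + \<epsilon>" using m(2) \<open>0 < d\<close> by (simp add: field_simps)
          finally show "(INF y\<in>C. norm y) \<le> 1 + \<epsilon>" .
        qed
      qed
      then have "vnorm ?V C = 1" by (simp add: quotient_space_def)
      moreover have "C \<in> carrier ?V" by (auto simp: quotient_space_def C_def)
      ultimately obtain s where s: "s \<in> F" "e < vnorm ?V (vdiff ?V (\<pi> s ` C) C)" using gap by blast
      have "(1/d) *\<^sub>R x \<in> C" using M_0 by (force simp: C_def)
      have "\<pi> s ((1/d) *\<^sub>R x) - (1/d) *\<^sub>R x \<in> vdiff ?V (\<pi> s ` C) C"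
      proof -
        have "- ((1/d) *\<^sub>R x) = (-1) *\<^sub>C ((1/d) *\<^sub>R x) + 0"
          using scaleC_of_real[of "-1" "(1/d) *\<^sub>R x"] by simp
        then have "- ((1/d) *\<^sub>R x) \<in> {(-1) *\<^sub>C y + m | y m. y \<in> C \<and> m \<in> M}"
          using \<open>(1/d) *\<^sub>R x \<in> C\<close> M_0 by blast
        moreover have "vdiff ?V (\<pi> s ` C) C =
            {u + w | u w. u \<in> \<pi> s ` C \<and> w \<in> {(-1) *\<^sub>C y + m | y m. y \<in> C \<and> m \<in> M}}"
          by (simp add: vdiff_def quotient_space_def)
        ultimately show ?thesis
          using \<open>(1/d) *\<^sub>R x \<in> C\<close> diff_conv_add_uminus by blast
      qed
      then have "vnorm ?V (vdiff ?V (\<pi> s ` C) C) \<le> norm (\<pi> s ((1/d) *\<^sub>R x) - (1/d) *\<^sub>R x)"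
        unfolding quotient_space_def cspace.simps
        by (intro cINF_lower) (auto intro: bdd_belowI2[where m = 0] simp: quotient_space_def)
      also have "\<dots> = norm (\<pi> s x - x) / d"
        using s(1) F(2) \<open>0 < d\<close> by (simp add: pi(4) subsetD scaleR_diff_right[symmetric])
      also have "\<dots> \<le> \<delta> / d" using small[OF s(1)] \<open>0 < d\<close> by (simp add: divide_right_mono)
      also have "\<dots> < e" using far \<open>0 < d\<close> e by (simp add: field_simps)
      finally show False using s(2) by simp
    qed
    moreover have "norm (\<pi> n x - x) / 2 \<le> d"
      unfolding d_def
    proof (rule cINF_greatest)
      show "M \<noteq> {}" using M_0 by blast
      fix m assume "m \<in> M"
      then have eq: "\<pi> n x - x = \<pi> n (x + m) - (x + m)"
        using n NH by (simp add: M_def invariant_vectors_def pi(1))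
      show "norm (\<pi> n x - x) / 2 \<le> norm (x + m)"
        unfolding eq using norm_triangle_ineq4[of "\<pi> n (x + m)" "x + m"] n NH by (simp add: pi(5))
    qed
    ultimately have "norm (\<pi> n x - x) / 2 \<le> \<delta> / e" by linarith
    then show ?thesis by (simp add: mult.commute)
  qed
  then show ?thesis using F by (intro exI[of _ F] exI[of _ "2 / e"]) blast
qed


text \<open>The vector \<open>c z\<close> is moved by the gap set of \<open>H\<close> by an amount
  independent of \<open>z\<close>, hence the same holds for \<open>M\<close>.\<close>

lemma (in isometric_cocycle) relative_T_commuting_displacement:
  fixes H :: "'h monoid"
  assumes T: "relative_T H M TYPE('b)" and "M \<subseteq> carrier H"
    and \<phi>: "\<And>h. h \<in> carrier H \<Longrightarrow> \<phi> h \<in> carrier G"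
    and \<phi>_mult: "\<And>h k. \<lbrakk>h \<in> carrier H; k \<in> carrier H\<rbrakk> \<Longrightarrow> \<phi> (h \<otimes>\<^bsub>H\<^esub> k) = \<phi> h \<otimes> \<phi> k"
  shows "\<exists>D. \<forall>z\<in>carrier G. (\<forall>h\<in>carrier H. \<phi> h \<otimes> z = z \<otimes> \<phi> h) \<longrightarrow>
    (\<forall>m\<in>M. norm (\<rho> (\<phi> m) (c z) - c z) \<le> D)"
proof -
  have rep': "isometric_representation H (\<lambda>h. \<rho> (\<phi> h))"
    using rep \<phi> \<phi>_mult by (simp add: isometric_representation_def hom_def Pi_iff)
  obtain F K where F: "finite F" "F \<subseteq> carrier H"
    and K: "\<forall>x \<delta>. 0 \<le> \<delta> \<longrightarrow> (\<forall>s\<in>F. norm (\<rho> (\<phi> s) x - x) \<le> \<delta>) \<longrightarrow>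
      (\<forall>m\<in>M. norm (\<rho> (\<phi> m) x - x) \<le> K * \<delta>)"
    using relative_T_displacement[OF T rep' assms(2)] by (elim exE conjE)
  define \<delta> where "\<delta> = (\<Sum>s\<in>F. 2 * norm (c (\<phi> s)))"
  have "norm (\<rho> (\<phi> m) (c z) - c z) \<le> K * \<delta>"
    if z: "z \<in> carrier G" and comm: "\<And>h. h \<in> carrier H \<Longrightarrow> \<phi> h \<otimes> z = z \<otimes> \<phi> h" and m: "m \<in> M" for z m
  proof (rule K[rule_format, OF _ _ m])
    show "0 \<le> \<delta>" by (simp add: \<delta>_def sum_nonneg)
    fix s assume s: "s \<in> F"
    then have "norm (\<rho> (\<phi> s) (c z) - c z) \<le> 2 * norm (c (\<phi> s))"
      using F(2) by (intro commuting_displacement[OF \<phi> z comm]) blast+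
    also have "\<dots> \<le> \<delta>"
      unfolding \<delta>_def using F(1) s by (intro member_le_sum) auto
    finally show "norm (\<rho> (\<phi> s) (c z) - c z) \<le> \<delta>" .
  qed
  then show ?thesis by blast
qed

section \<open>Matrices over a subring\<close>

locale coefficient_subring =
  fixes A :: "'a::comm_ring_1 set"
  assumes zero [simp]: "0 \<in> A" and one [simp]: "1 \<in> A"
    and add [simp]: "\<lbrakk>x \<in> A; y \<in> A\<rbrakk> \<Longrightarrow> x + y \<in> A"
    and mult [simp]: "\<lbrakk>x \<in> A; y \<in> A\<rbrakk> \<Longrightarrow> x * y \<in> A"
    and uminus [simp]: "x \<in> A \<Longrightarrow> - x \<in> A"
begin

lemma diff [simp]: "\<lbrakk>x \<in> A; y \<in> A\<rbrakk> \<Longrightarrow> x - y \<in> A"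
  using add[of x "- y"] by simp

lemma of_nat [simp]: "of_nat m \<in> A"
  by (induction m) auto

lemma sum: "(\<And>i. i \<in> I \<Longrightarrow> f i \<in> A) \<Longrightarrow> sum f I \<in> A"
  by (induction I rule: infinite_finite_induct) auto

lemma matrix_mult_closed: "\<lbrakk>g \<in> matrices_over A; h \<in> matrices_over A\<rbrakk> \<Longrightarrow> g ** h \<in> matrices_over A"
  by (auto simp: matrices_over_def matrix_matrix_mult_def intro!: sum)

lemma mat_1_closed: "mat 1 \<in> matrices_over A"
  by (simp add: matrices_over_def mat_def)

lemma group_GL: "group (GL A :: ('a^'n^'n) monoid)"
  unfolding GL_def
  by (intro monoid.units_group monoidI)
     (auto simp: matrix_mult_closed matrix_mul_assoc mat_1_closed)

lemma mat_1_EL: "mat 1 \<in> EL A"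
proof -
  have "\<one>\<^bsub>GL A\<^esub> \<in> EL A" unfolding EL_def by (rule generate.one)
  then show ?thesis by (simp add: GL_def units_of_def)
qed

lemma EL_2_subset_SL: "(EL A :: ('a^2^2) set) \<subseteq> SL A"
proof -
  let ?GL = "GL A :: ('a^2^2) monoid"
  interpret GL: group ?GL by (rule group_GL)
  have mult: "x \<otimes>\<^bsub>?GL\<^esub> y = x ** y" and GL_one: "\<one>\<^bsub>?GL\<^esub> = mat 1" for x y
    by (simp_all add: GL_def units_of_def)
  have GL_matrices: "x \<in> matrices_over A" if "x \<in> carrier ?GL" for x
    using that by (simp add: GL_def units_of_def Units_def)
  have elementary: "elementary_matrix i j a \<in> carrier ?GL \<and> det (elementary_matrix i j a) = 1"
    if "i \<noteq> j" "a \<in> A" for i j :: 2 and a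
  proof -
    have "elementary_matrix i j x ** elementary_matrix i j y = elementary_matrix i j (x + y)" for x y :: 'a
      using \<open>i \<noteq> j\<close>
      by (auto simp: vec_eq_iff matrix_matrix_mult_def elementary_matrix_def sum_2 forall_2)
    moreover have "elementary_matrix i j 0 = (mat 1 :: 'a^2^2)"
      by (simp add: elementary_matrix_def mat_def vec_eq_iff)
    moreover have "elementary_matrix i j x \<in> matrices_over A" if "x \<in> A" for x
      using that by (simp add: elementary_matrix_def matrices_over_def)
    ultimately have "elementary_matrix i j a \<in> carrier ?GL"
      using \<open>a \<in> A\<close> uminus[of a]
      by (auto simp: GL_def units_of_def Units_def intro!: bexI[of _ "elementary_matrix i j (- a)"])
    then show ?thesis
      using \<open>i \<noteq> j\<close> by (auto simp: det_2 elementary_matrix_def)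
  qed
  have "x \<in> carrier ?GL \<and> det x = 1" if "x \<in> EL A" for x :: "'a^2^2"
    using that unfolding EL_def
  proof (induction rule: generate.induct)
    case one
    show ?case using GL.one_closed by (simp add: GL_one)
  next
    case (incl h)
    then show ?case using elementary by auto
  next
    case (inv h)
    then have h: "h \<in> carrier ?GL" "det h = 1" using elementary by auto
    then have "h ** inv\<^bsub>?GL\<^esub> h = mat 1" using GL.r_inv[of h] by (simp only: mult GL_one)
    then have "det h * det (inv\<^bsub>?GL\<^esub> h) = 1" by (metis det_mul det_I)
    then show ?case using h by simp
  next
    case (eng g h)
    then show ?case using GL.m_closed[of g h] by (simp add: mult det_mul)
  qed
  then show ?thesis using GL_matrices by (auto simp: SL_def)
qed

end

lemma coefficient_subring_zpoly_ring: "coefficient_subring (zpoly_ring k)"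
proof
  fix p q :: zpoly assume p: "p \<in> zpoly_ring k" and q: "q \<in> zpoly_ring k"
  show "p + q \<in> zpoly_ring k"
    using p q keys_add[of p q] by (auto simp: zpoly_ring_def)
  show "p * q \<in> zpoly_ring k"
  proof -
    have "Poly_Mapping.keys m \<subseteq> {..<k}" if m: "m \<in> Poly_Mapping.keys (p * q)" for m
    proof -
      obtain m1 m2 where "m = m1 + m2" "m1 \<in> Poly_Mapping.keys p" "m2 \<in> Poly_Mapping.keys q"
        using keys_mult[of p q] m by blast
      then show ?thesis using p q keys_add[of m1 m2] unfolding zpoly_ring_def by blast
    qed
    then show ?thesis by (simp add: zpoly_ring_def)
  qed
  show "- p \<in> zpoly_ring k" using p by (simp add: zpoly_ring_def)
qed (simp_all add: zpoly_ring_def)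

lemma semidirect_mult [simp]:
  "(g, v) \<otimes>\<^bsub>semidirect H A\<^esub> (h, w) = (g ** h, v + g *v w)"
  by (simp add: semidirect_def)

lemma semidirect_carrier [simp]: "carrier (semidirect H A) = H \<times> vectors_over A"
  by (simp add: semidirect_def)

lemma semidirect_one [simp]: "\<one>\<^bsub>semidirect H A\<^esub> = (mat 1, 0)"
  by (simp add: semidirect_def)

definition column_embedding :: "('a::comm_ring_1^2^2) \<times> ('a^2) \<Rightarrow> ('a^3^3) \<times> ('a^3)" where
  "column_embedding = (\<lambda>(h, v).
     (vector [vector [h$1$1, h$1$2, 0], vector [h$2$1, h$2$2, 0], vector [0, 0, 1]],
      vector [v$1, v$2, 0]))"

text \<open>For \<open>h\<close> of determinant 1, the pair \<open>(h, v)\<close> is the block matrix with columns \<open>(h, 0)\<close> and \<open>(v, 1)\<close>; this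
  is its inverse transpose. The inverse is written with cofactors. The
  pairs \<open>(mat 1, v)\<close> become matrices that subtract multiples of the first two coordinates from the
  third.\<close>

definition row_embedding :: "('a::comm_ring_1^2^2) \<times> ('a^2) \<Rightarrow> ('a^3^3) \<times> ('a^3)" where
  "row_embedding = (\<lambda>(h, v).
     (vector [vector [h$2$2, - (h$2$1), 0], vector [- (h$1$2), h$1$1, 0],
              vector [v$2 * h$1$2 - v$1 * h$2$2, v$1 * h$2$1 - v$2 * h$1$1, 1]],
      0))"

lemma column_embedding_mult:
  "column_embedding (x \<otimes>\<^bsub>semidirect H A\<^esub> y) = column_embedding x \<otimes>\<^bsub>semidirect K A\<^esub> column_embedding y"
  by (cases x; cases y)
    (simp add: column_embedding_def vec_eq_iff forall_3 forall_2 matrix_matrix_mult_def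
      matrix_vector_mult_def sum_2 sum_3)

lemma row_embedding_mult:
  assumes "det (fst x) = 1"
  shows "row_embedding (x \<otimes>\<^bsub>semidirect H A\<^esub> y) = row_embedding x \<otimes>\<^bsub>semidirect K A\<^esub> row_embedding y"
proof -
  obtain g v h w where xy: "x = (g, v)" "y = (h, w)" by fastforce
  have det: "g$1$1 * g$2$2 - g$1$2 * g$2$1 = 1" using assms by (simp add: xy det_2)
  have "(v$2 + (g$2$1 * w$1 + g$2$2 * w$2)) * (g$1$1 * h$1$2 + g$1$2 * h$2$2)
      - (v$1 + (g$1$1 * w$1 + g$1$2 * w$2)) * (g$2$1 * h$1$2 + g$2$2 * h$2$2)
    = (v$2 * g$1$2 - v$1 * g$2$2) * h$2$2 - (v$1 * g$2$1 - v$2 * g$1$1) * h$1$2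
      + (g$1$1 * g$2$2 - g$1$2 * g$2$1) * (w$2 * h$1$2 - w$1 * h$2$2)"
    by (simp add: algebra_simps)
  note row_1 = this[unfolded det mult_1_left]
  have "(v$1 + (g$1$1 * w$1 + g$1$2 * w$2)) * (g$2$1 * h$1$1 + g$2$2 * h$2$1)
      - (v$2 + (g$2$1 * w$1 + g$2$2 * w$2)) * (g$1$1 * h$1$1 + g$1$2 * h$2$1)
    = (v$1 * g$2$1 - v$2 * g$1$1) * h$1$1 - (v$2 * g$1$2 - v$1 * g$2$2) * h$2$1
      + (g$1$1 * g$2$2 - g$1$2 * g$2$1) * (w$1 * h$2$1 - w$2 * h$1$1)"
    by (simp add: algebra_simps)
  note row_2 = this[unfolded det mult_1_left]
  show ?thesis
    unfolding xy using row_1 row_2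
    by (simp add: row_embedding_def vec_eq_iff forall_3 matrix_matrix_mult_def
      matrix_vector_mult_def sum_2 sum_3)
qed

lemma (in coefficient_subring) embeddings_closed:
  assumes "x \<in> SL A \<times> vectors_over A"
  shows "column_embedding x \<in> SL A \<times> vectors_over A" and "row_embedding x \<in> SL A \<times> vectors_over A"
proof -
  obtain g v where x: "x = (g, v)" by fastforce
  have "g$i$j \<in> A" "v$i \<in> A" "det g = 1" for i j
    using assms by (auto simp: x SL_def matrices_over_def vectors_over_def)
  then show "column_embedding x \<in> SL A \<times> vectors_over A" "row_embedding x \<in> SL A \<times> vectors_over A"
    by (auto simp: x column_embedding_def row_embedding_def SL_def matrices_over_def vectors_over_def
      forall_3 det_2 det_3 algebra_simps)
qed

section \<open>Affine actions of the semidirect product\<close>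

locale affine_SL3 = coefficient_subring A +
  isometric_cocycle "semidirect (SL A :: ('a::comm_ring_1^3^3) set) A" \<rho> c
  for A :: "'a::comm_ring_1 set" and \<rho> :: "('a::comm_ring_1^3^3) \<times> ('a^3) \<Rightarrow> 'b::complex_banach \<Rightarrow> 'b" and c
begin

abbreviation G where "G \<equiv> semidirect (SL A :: ('a^3^3) set) A"

definition transl :: "'a \<Rightarrow> 'a \<Rightarrow> 'a \<Rightarrow> ('a^3^3) \<times> ('a^3)" where
  "transl x y z = (mat 1, vector [x, y, z])"

lemma transl_eq: "transl (v$1) (v$2) (v$3) = (mat 1, v)"
  by (simp add: transl_def vec_eq_iff forall_3)

lemma mat_1_SL: "mat 1 \<in> SL A"
  by (simp add: SL_def mat_1_closed)

lemma transl_closed [simp]: "\<lbrakk>x \<in> A; y \<in> A; z \<in> A\<rbrakk> \<Longrightarrow> transl x y z \<in> carrier G"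
  by (simp add: transl_def vectors_over_def forall_3 mat_1_SL)

lemma transl_mult:
  "transl x y z \<otimes>\<^bsub>G\<^esub> transl x' y' z' = transl (x + x') (y + y') (z + z')"
  by (simp add: transl_def vec_eq_iff forall_3)

lemma transl_one: "transl 0 0 0 = \<one>\<^bsub>G\<^esub>"
  by (simp add: transl_def vec_eq_iff forall_3)

lemma transl_inv: "\<lbrakk>x \<in> A; y \<in> A; z \<in> A\<rbrakk> \<Longrightarrow> inv\<^bsub>G\<^esub> transl x y z = transl (- x) (- y) (- z)"
  by (rule inv_equality) (simp_all add: transl_mult transl_one del: semidirect_one semidirect_carrier)

lemma transl_pow: "transl x y z [^]\<^bsub>G\<^esub> (m::nat) = transl (of_nat m * x) (of_nat m * y) (of_nat m * z)"
  by (induction m) (simp_all add: transl_one transl_mult algebra_simps del: semidirect_one)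

lemma translation_subgroup_iff:
  "n \<in> translation_subgroup A \<longleftrightarrow> (\<exists>x\<in>A. \<exists>y\<in>A. \<exists>z\<in>A. n = transl x y z)"
proof
  assume "n \<in> translation_subgroup A"
  then obtain v where "v \<in> vectors_over A" "n = (mat 1, v)" by (auto simp: translation_subgroup_def)
  then show "\<exists>x\<in>A. \<exists>y\<in>A. \<exists>z\<in>A. n = transl x y z"
    by (intro bexI[of _ "v$1"] bexI[of _ "v$2"] bexI[of _ "v$3"]) (simp_all add: transl_eq vectors_over_def)
qed (auto simp: translation_subgroup_def transl_def vectors_over_def forall_3)

lemma subgroup_translations: "subgroup (translation_subgroup A) G"
proof
  show "translation_subgroup A \<subseteq> carrier G"
    by (auto simp only: translation_subgroup_iff transl_closed)
  show "\<one>\<^bsub>G\<^esub> \<in> translation_subgroup A"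
    by (simp add: translation_subgroup_def vectors_over_def)
  show "m \<otimes>\<^bsub>G\<^esub> n \<in> translation_subgroup A"
    if "m \<in> translation_subgroup A" "n \<in> translation_subgroup A" for m n
    using that unfolding translation_subgroup_iff by (auto simp only: transl_mult intro!: bexI add)
  show "inv\<^bsub>G\<^esub> n \<in> translation_subgroup A" if "n \<in> translation_subgroup A" for n
    using that unfolding translation_subgroup_iff by (auto simp only: transl_inv intro!: bexI uminus)
qed

text \<open>Conjugating a translation by a matrix applies the matrix to the translation vector.\<close>

lemma matrix_transl:
  "(M, 0) \<otimes>\<^bsub>G\<^esub> transl x y z = transl x' y' z' \<otimes>\<^bsub>G\<^esub> (M, 0) \<longleftrightarrow> M *v vector [x, y, z] = vector [x', y', z']"
  by (simp add: transl_def)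

lemma SL_closed: "M \<in> SL A \<Longrightarrow> (M, 0) \<in> carrier G"
  by (simp add: vectors_over_def)

text \<open>Translations along the first two coordinates are in the column copy of \<open>A\<^sup>2\<close>. The translation by
  \<open>(1, 0, z)\<close> is the conjugate of the translation by \<open>(1, 0, 0)\<close> by an element of the row copy, so it
  moves \<open>c (transl 0 0 a)\<close> by a bounded amount as well, and every translation is a product of one of each kind.\<close>

lemma last_coordinate_displacement:
  assumes T: "relative_T (semidirect (EL A :: ('a^2^2) set) A) (translation_subgroup A) TYPE('b)"
  obtains D where "\<And>a n. \<lbrakk>a \<in> A; n \<in> translation_subgroup A\<rbrakk>
      \<Longrightarrow> norm (\<rho> n (c (transl 0 0 a)) - c (transl 0 0 a)) \<le> D"
proof -
  let ?H = "semidirect (EL A :: ('a^2^2) set) A"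
  have H: "x \<in> SL A \<times> vectors_over A" "det (fst x) = 1" if "x \<in> carrier ?H" for x
    using that EL_2_subset_SL by (auto simp: SL_def)
  have sub: "translation_subgroup A \<subseteq> carrier ?H"
    by (auto simp: translation_subgroup_def mat_1_EL)
  have mem: "(mat 1 :: 'a^2^2, vector [x, y] :: 'a^2) \<in> translation_subgroup A" if "x \<in> A" "y \<in> A" for x y
    using that by (simp add: translation_subgroup_def vectors_over_def forall_2)
  have comm: "column_embedding h \<otimes>\<^bsub>G\<^esub> transl 0 0 a = transl 0 0 a \<otimes>\<^bsub>G\<^esub> column_embedding h"
    "row_embedding h \<otimes>\<^bsub>G\<^esub> transl 0 0 a = transl 0 0 a \<otimes>\<^bsub>G\<^esub> row_embedding h" for h a
    by (cases h; simp add: column_embedding_def row_embedding_def transl_def;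
        simp add: vec_eq_iff forall_3 matrix_vector_mult_def sum_3)+
  have "\<exists>D. \<forall>z\<in>carrier G. (\<forall>h\<in>carrier ?H. column_embedding h \<otimes>\<^bsub>G\<^esub> z = z \<otimes>\<^bsub>G\<^esub> column_embedding h) \<longrightarrow>
      (\<forall>m\<in>translation_subgroup A. norm (\<rho> (column_embedding m) (c z) - c z) \<le> D)"
  proof (rule relative_T_commuting_displacement[OF T sub])
    show "column_embedding h \<in> carrier G" if "h \<in> carrier ?H" for h
      using embeddings_closed[OF H(1)[OF that]] by simp
    show "column_embedding (h \<otimes>\<^bsub>?H\<^esub> k) = column_embedding h \<otimes>\<^bsub>G\<^esub> column_embedding k"
      if "h \<in> carrier ?H" "k \<in> carrier ?H" for h k
      by (rule column_embedding_mult)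
  qed
  then obtain D1 where D1: "norm (\<rho> (column_embedding m) (c z) - c z) \<le> D1"
    if "z \<in> carrier G" "\<forall>h\<in>carrier ?H. column_embedding h \<otimes>\<^bsub>G\<^esub> z = z \<otimes>\<^bsub>G\<^esub> column_embedding h" "m \<in> translation_subgroup A" for z m
    by blast
  have "\<exists>D. \<forall>z\<in>carrier G. (\<forall>h\<in>carrier ?H. row_embedding h \<otimes>\<^bsub>G\<^esub> z = z \<otimes>\<^bsub>G\<^esub> row_embedding h) \<longrightarrow>
      (\<forall>m\<in>translation_subgroup A. norm (\<rho> (row_embedding m) (c z) - c z) \<le> D)"
  proof (rule relative_T_commuting_displacement[OF T sub])
    show "row_embedding h \<in> carrier G" if "h \<in> carrier ?H" for h
      using embeddings_closed[OF H(1)[OF that]] by simp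
    show "row_embedding (h \<otimes>\<^bsub>?H\<^esub> k) = row_embedding h \<otimes>\<^bsub>G\<^esub> row_embedding k"
      if "h \<in> carrier ?H" "k \<in> carrier ?H" for h k
      using H(2)[OF that(1)] by (rule row_embedding_mult)
  qed
  then obtain D2 where D2: "norm (\<rho> (row_embedding m) (c z) - c z) \<le> D2"
    if "z \<in> carrier G" "\<forall>h\<in>carrier ?H. row_embedding h \<otimes>\<^bsub>G\<^esub> z = z \<otimes>\<^bsub>G\<^esub> row_embedding h" "m \<in> translation_subgroup A" for z m
    by blast
  have column: "norm (\<rho> (transl x y 0) (c (transl 0 0 a)) - c (transl 0 0 a)) \<le> D1"
    if "x \<in> A" "y \<in> A" "a \<in> A" for x y a
  proof -
    have "column_embedding (mat 1, vector [x, y]) = transl x y 0"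
      by (simp add: column_embedding_def transl_def vec_eq_iff forall_3 mat_def)
    then show ?thesis using D1[OF transl_closed _ mem, of 0 0 a x y] comm(1) that by simp
  qed
  have row: "norm (\<rho> (row_embedding (mat 1, vector [x, 0])) (c (transl 0 0 a)) - c (transl 0 0 a)) \<le> D2"
    if "x \<in> A" "a \<in> A" for x a
    using D2[OF transl_closed _ mem, of 0 0 a x 0] comm(2) that by simp
  have "norm (\<rho> n (c (transl 0 0 a)) - c (transl 0 0 a)) \<le> D1 + (D1 + 2 * D2)"
    if a: "a \<in> A" and n_transl: "n \<in> translation_subgroup A" for a n
  proof -
    let ?\<xi> = "c (transl 0 0 a)"
    obtain x y z where n: "x \<in> A" "y \<in> A" "z \<in> A" "n = transl x y z"
      using n_transl by (auto simp: translation_subgroup_iff)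
    let ?l = "row_embedding (mat 1, vector [- z, 0])"
    have "(mat 1 :: 'a^2^2, vector [- z, 0] :: 'a^2) \<in> SL A \<times> vectors_over A"
      using n(3) by (simp add: SL_def mat_1_closed vectors_over_def forall_2)
    then have l: "?l \<in> carrier G" using embeddings_closed(2) by simp
    have "?l \<otimes>\<^bsub>G\<^esub> transl 1 0 0 = transl 1 0 z \<otimes>\<^bsub>G\<^esub> ?l"
      by (simp add: row_embedding_def matrix_transl)
         (simp add: mat_def vec_eq_iff forall_3 matrix_vector_mult_def sum_3)
    then have "norm (\<rho> (transl 1 0 z) ?\<xi> - ?\<xi>) \<le> norm (\<rho> (transl 1 0 0) ?\<xi> - ?\<xi>) + 2 * norm (\<rho> ?l ?\<xi> - ?\<xi>)"
      using l n by (intro displacement_conj) (simp_all del: semidirect_carrier)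
    also have "\<dots> \<le> D1 + 2 * D2"
      using column[of 1 0 a] row[of "- z" a] a n(3) by simp
    finally have "norm (\<rho> (transl 1 0 z) ?\<xi> - ?\<xi>) \<le> D1 + 2 * D2" .
    moreover have "n = transl (x - 1) y 0 \<otimes>\<^bsub>G\<^esub> transl 1 0 z" by (simp add: n(4) transl_mult)
    ultimately show ?thesis
      using displacement_mult[of "transl (x - 1) y 0" "transl 1 0 z" ?\<xi>] column[of "x - 1" y a] a n
      by (simp del: semidirect_carrier)
  qed
  then show thesis by (rule that)
qed

text \<open>With \<open>w\<close> the unit translation along the second coordinate and \<open>M\<close> the elementary matrix that adds \<open>p a\<close>
  times the second coordinate to the third, \<open>M w\<^sup>q M\<inverse> w\<^sup>-\<^sup>q\<close> is the translation by \<open>p q a\<close> along the third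
  coordinate. Its cocycle has norm at most \<open>2 q \<parallel>c(w)\<parallel> + 2 \<parallel>c(M)\<parallel>\<close>, which is at most \<open>p q\<close> once first \<open>p\<close> is
  chosen large and then \<open>q\<close>, depending on \<open>M\<close> and so on \<open>p\<close>.\<close>

lemma last_coordinate_slow_growth:
  assumes a: "a \<in> A"
  obtains m :: nat where "0 < m" and "norm (c (transl 0 0 a [^]\<^bsub>G\<^esub> m)) \<le> real m"
proof -
  define w :: "('a^3^3) \<times> ('a^3)" where "w = transl 0 1 0"
  have w: "w \<in> carrier G" by (simp add: w_def del: semidirect_carrier)
  have nat_above: "\<exists>p::nat. 0 < p \<and> x \<le> real p" for x
  proof -
    obtain n :: nat where "x \<le> real n" using real_arch_simple by blast
    then show ?thesis by (intro exI[of _ "Suc n"]) simp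
  qed
  obtain p :: nat where p: "0 < p" "4 * norm (c w) \<le> real p" using nat_above by blast
  define M :: "'a^3^3" where
    "M = vector [vector [1, 0, 0], vector [0, 1, 0], vector [0, of_nat p * a, 1]]"
  have M: "(M, 0) \<in> carrier G"
    using a by (intro SL_closed) (simp add: SL_def matrices_over_def M_def forall_3 det_3)
  obtain q :: nat where q: "0 < q" "4 * norm (c (M, 0)) \<le> real q" using nat_above by blast
  have w_pow: "norm (c (transl 0 (of_nat q) 0)) \<le> real q * norm (c w)"
  proof -
    have "norm (c (w [^]\<^bsub>G\<^esub> q) - real q *\<^sub>R 0) \<le> real q * norm (c w - 0)"
      using w rho(4)[OF w, of 0 0] by (intro cocycle_pow_near) simp_all
    then show ?thesis by (simp add: w_def transl_pow)
  qed
  have "(M, 0) \<otimes>\<^bsub>G\<^esub> transl 0 (of_nat q) 0 = transl 0 (of_nat q) (of_nat (p * q) * a) \<otimes>\<^bsub>G\<^esub> (M, 0)"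
    by (simp only: matrix_transl)
       (simp add: M_def vec_eq_iff forall_3 matrix_vector_mult_def sum_3 algebra_simps)
  then have conj: "norm (c (transl 0 (of_nat q) (of_nat (p * q) * a))) \<le>
      norm (c (transl 0 (of_nat q) 0)) + 2 * norm (c (M, 0))"
    using M a by (intro norm_cocycle_conj) (simp_all del: semidirect_carrier of_nat_mult)
  have "transl 0 0 a [^]\<^bsub>G\<^esub> (p * q) =
      transl 0 (of_nat q) (of_nat (p * q) * a) \<otimes>\<^bsub>G\<^esub> inv\<^bsub>G\<^esub> transl 0 (of_nat q) 0"
    by (simp add: transl_inv transl_mult transl_pow)
  then have "norm (c (transl 0 0 a [^]\<^bsub>G\<^esub> (p * q))) \<le>
      norm (c (transl 0 (of_nat q) (of_nat (p * q) * a))) + norm (c (transl 0 (of_nat q) 0))"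
    using norm_cocycle_mult[of "transl 0 (of_nat q) (of_nat (p * q) * a)" "inv\<^bsub>G\<^esub> transl 0 (of_nat q) 0"]
      norm_cocycle_inv[of "transl 0 (of_nat q) 0"] a
    by (simp del: semidirect_carrier of_nat_mult)
  also have "\<dots> \<le> real q * (2 * norm (c w)) + 2 * norm (c (M, 0))"
    using conj w_pow by linarith
  also have "\<dots> \<le> real q * (real p / 2) + real q * real p / 2"
  proof (rule add_mono)
    show "real q * (2 * norm (c w)) \<le> real q * (real p / 2)" using p by (intro mult_left_mono) auto
    have "real q * 1 \<le> real q * real p" using p by (intro mult_left_mono) auto
    then show "2 * norm (c (M, 0)) \<le> real q * real p / 2" using q(2) by linarith
  qed
  also have "\<dots> = real (p * q)" by simp
  finally show thesis using that[of "p * q"] p q by simp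
qed

lemma cocycle_bounded_on_last_coordinate:
  assumes superreflexive: "superreflexive (space_of TYPE('b))"
    and T: "relative_T (semidirect (EL A :: ('a^2^2) set) A) (translation_subgroup A) TYPE('b)"
  obtains C where "\<And>a. a \<in> A \<Longrightarrow> norm (c (transl 0 0 a)) \<le> C"
proof -
  obtain p :: "'b \<Rightarrow> real" and r s where p: "uniformly_convex_norm p r s"
    using superreflexive_uniformly_convex_norm[OF superreflexive] by blast
  obtain D where D: "\<And>a n. \<lbrakk>a \<in> A; n \<in> translation_subgroup A\<rbrakk>
      \<Longrightarrow> norm (\<rho> n (c (transl 0 0 a)) - c (transl 0 0 a)) \<le> D"
    using last_coordinate_displacement[OF T] by blast
  interpret linear_part: isometric_cocycle G \<rho> "\<lambda>_. 0"
    by unfold_locales (use rep rho(4)[of _ 0 0] in auto)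
  define E where "E = 2 * s / r * D"
  have "norm (c (transl 0 0 a)) \<le> 2 * E + 1" if a: "a \<in> A" for a
  proof -
    let ?z = "transl 0 0 a"
    obtain y where y: "\<And>n. n \<in> translation_subgroup A \<Longrightarrow> \<rho> n y = y" "norm (y - c ?z) \<le> E"
      using linear_part.fixed_point_of_bounded_orbit[OF p subgroup_translations, of "c ?z" D] D[OF a]
      unfolding E_def by auto
    obtain m :: nat where m: "0 < m" "norm (c (?z [^]\<^bsub>G\<^esub> m)) \<le> real m"
      using last_coordinate_slow_growth[OF a] by blast
    have "\<rho> ?z y = y" using y(1) a zero translation_subgroup_iff by blast
    then have "norm (c (?z [^]\<^bsub>G\<^esub> m) - real m *\<^sub>R y) \<le> real m * norm (c ?z - y)"
      using a by (intro cocycle_pow_near) (simp_all del: semidirect_carrier)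
    also have "\<dots> \<le> real m * E" using y(2) by (intro mult_left_mono) (simp_all add: norm_minus_commute)
    finally have "real m * norm y \<le> real m * E + real m"
      using m(2) norm_triangle_sub[of "real m *\<^sub>R y" "c (?z [^]\<^bsub>G\<^esub> m)"] by (simp add: norm_minus_commute)
    then have "real m * norm y \<le> real m * (E + 1)" by (simp add: distrib_left)
    then have "norm y \<le> E + 1" using m(1) by simp
    moreover have "norm (c ?z) \<le> norm y + norm (y - c ?z)"
      using norm_triangle_sub[of "c ?z" y] by (simp add: norm_minus_commute)
    ultimately show ?thesis using y(2) by linarith
  qed
  then show thesis by (rule that)
qed

text \<open>The cyclic permutation matrix \<open>P\<close> has determinant 1 and carries the third coordinate to the others.\<close>

lemma cocycle_bounded_on_translations:
  assumes C: "\<And>a. a \<in> A \<Longrightarrow> norm (c (transl 0 0 a)) \<le> C"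
  obtains C' where "\<And>n. n \<in> translation_subgroup A \<Longrightarrow> norm (c n) \<le> C'"
proof -
  define P :: "'a^3^3" where "P = vector [vector [0, 0, 1], vector [1, 0, 0], vector [0, 1, 0]]"
  have P: "(P, 0) \<in> carrier G"
    by (intro SL_closed) (simp add: SL_def matrices_over_def P_def forall_3 det_3)
  have rotate: "norm (c (transl z x y)) \<le> norm (c (transl x y z)) + 2 * norm (c (P, 0))"
    if "x \<in> A" "y \<in> A" "z \<in> A" for x y z
  proof -
    have "(P, 0) \<otimes>\<^bsub>G\<^esub> transl x y z = transl z x y \<otimes>\<^bsub>G\<^esub> (P, 0)"
      by (simp only: matrix_transl)
         (simp add: P_def vec_eq_iff forall_3 matrix_vector_mult_def sum_3)
    then show ?thesis using P that by (intro norm_cocycle_conj) (simp_all del: semidirect_carrier)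
  qed
  have "norm (c n) \<le> 3 * C + 6 * norm (c (P, 0))" if n_transl: "n \<in> translation_subgroup A" for n
  proof -
    obtain x y z where n: "x \<in> A" "y \<in> A" "z \<in> A" "n = transl x y z"
      using n_transl by (auto simp: translation_subgroup_iff)
    have "n = transl x 0 0 \<otimes>\<^bsub>G\<^esub> (transl 0 y 0 \<otimes>\<^bsub>G\<^esub> transl 0 0 z)" by (simp add: n(4) transl_mult)
    then have "norm (c n) \<le> norm (c (transl x 0 0)) + (norm (c (transl 0 y 0)) + norm (c (transl 0 0 z)))"
      using norm_cocycle_mult[of "transl x 0 0" "transl 0 y 0 \<otimes>\<^bsub>G\<^esub> transl 0 0 z"]
        norm_cocycle_mult[of "transl 0 y 0" "transl 0 0 z"] n
      by (simp add: transl_mult del: semidirect_carrier)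
    then show ?thesis
      using rotate[of 0 0 x] rotate[of 0 0 y] rotate[of y 0 0] C[of x] C[of y] C[of z] n by simp
  qed
  then show thesis by (rule that)
qed

end

theorem relative_F_of_relative_T:
  fixes A :: "'a::comm_ring_1 set"
  assumes A: "coefficient_subring A"
    and superreflexive: "superreflexive (space_of TYPE('b::complex_banach))"
    and T: "relative_T (semidirect (EL A :: ('a^2^2) set) A) (translation_subgroup A) TYPE('b)"
  shows "relative_F (semidirect (SL A :: ('a^3^3) set) A) (translation_subgroup A) TYPE('b)"
  unfolding relative_F_def
proof (intro allI impI)
  let ?G = "semidirect (SL A :: ('a^3^3) set) A"
  fix \<alpha> :: "('a^3^3) \<times> ('a^3) \<Rightarrow> 'b \<Rightarrow> 'b"
  assume "affine_isometric_action ?G \<alpha>"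
  then obtain \<rho> c where \<alpha>: "group_action ?G UNIV \<alpha>" and rep: "isometric_representation ?G \<rho>"
    and affine: "\<And>g x. g \<in> carrier ?G \<Longrightarrow> \<alpha> g x = \<rho> g x + c g"
    unfolding affine_isometric_action_def by blast
  have "group ?G" using \<alpha> by (simp add: group_action_def group_hom_def)
  then have "isometric_cocycle ?G \<rho> c"
  proof (rule isometric_cocycle.intro, unfold_locales)
    show "isometric_representation ?G \<rho>" by (rule rep)
    fix g h assume gh: "g \<in> carrier ?G" "h \<in> carrier ?G"
    have "\<alpha> (g \<otimes>\<^bsub>?G\<^esub> h) 0 = \<alpha> g (\<alpha> h 0)"
      using group_action.composition_rule[OF \<alpha> _ gh] by simp
    then show "c (g \<otimes>\<^bsub>?G\<^esub> h) = c g + \<rho> g (c h)"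
      using gh \<open>group ?G\<close> isometric_representationD(4)[OF rep, of _ 0 0]
      by (simp add: affine group.is_monoid monoid.m_closed add.commute del: semidirect_carrier)
  qed
  then interpret affine_SL3 A \<rho> c using A by (simp add: affine_SL3_def)
  obtain C where "\<And>a. a \<in> A \<Longrightarrow> norm (c (transl 0 0 a)) \<le> C"
    using cocycle_bounded_on_last_coordinate[OF superreflexive T] by blast
  then obtain C' where C': "\<And>n. n \<in> translation_subgroup A \<Longrightarrow> norm (c n) \<le> C'"
    using cocycle_bounded_on_translations by blast
  obtain p :: "'b \<Rightarrow> real" and r s where p: "uniformly_convex_norm p r s"
    using superreflexive_uniformly_convex_norm[OF superreflexive] by blast
  have N: "n \<in> carrier ?G" if "n \<in> translation_subgroup A" for n
    using subgroup_translations that by (rule subgroup.mem_carrier)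
  have "norm (\<rho> n 0 + c n - 0) \<le> C'" if "n \<in> translation_subgroup A" for n
    using C'[OF that] rho(4)[OF N[OF that], of 0 0] by simp
  then obtain z where "\<And>n. n \<in> translation_subgroup A \<Longrightarrow> \<rho> n z + c n = z"
    using fixed_point_of_bounded_orbit[OF p subgroup_translations, of 0 C'] by blast
  then show "\<exists>\<xi>. \<forall>n\<in>translation_subgroup A. \<alpha> n \<xi> = \<xi>"
    using N affine by (intro exI[of _ z]) (simp del: semidirect_carrier)
qed

theorem theorem1p3:
  fixes k :: nat
  assumes "superreflexive (space_of TYPE('b::complex_banach))"
    and "relative_T
           (semidirect (EL (zpoly_ring k) :: (zpoly^2^2) set) (zpoly_ring k))
           (translation_subgroup (zpoly_ring k)) TYPE('b)"
  shows "relative_F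
           (semidirect (SL (zpoly_ring k) :: (zpoly^3^3) set) (zpoly_ring k))
           (translation_subgroup (zpoly_ring k)) TYPE('b)"
  using assms by (rule relative_F_of_relative_T[OF coefficient_subring_zpoly_ring])

end
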